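(* Consider problems (P) and (BP) described in the context. Suppose that Assumption 1 and Assumption 2 (both stated in the context) hold and that every $f_i$, $i\in\mathcal{V}$, is convex. Let $\tilde{\mathbf{x}}^\star$ be an optimal solution of (BP) and let $\underline{f}\le f^\star$. For any $\epsilon>0$, we have $f(\tilde{\mathbf{x}}^\star)-f^\star\le\epsilon$ whenever $$0<\rho\le\begin{cases}\dfrac{\epsilon}{2B(\mathbf{x}')}, & \text{if } f(\mathbf{x}')-\underline{f}\le\epsilon/2,\\[2mm] \dfrac{\epsilon^2}{4(f(\mathbf{x}')-\underline{f})B(\mathbf{x}')}, & \text{otherwise,}\end{cases}$$ for some feasible solution $\mathbf{x}'$ of (BP).
   Context: **Problem.** $\mathcal{G}=(\mathcal{V},\mathcal{E})$ is an undirected graph with $\mathcal{V}=\{1,\dots,n\}$; $\mathcal{N}_i=\{j:\{i,j\}\in\mathcal{E}\}$ and $\bar{\mathcal{N}}_i=\mathcal{N}_i\cup\{i\}$. For each $i\in\mathcal{V}$ there are a function $f_i:\mathbb{R}^{d_i}\to\mathbb{R}$, a set $\mathcal{X}_i\subset\mathbb{R}^{d_i}$ and a matrix $A_i\in\mathbb{R}^{m\times d_i}$; $c\in\mathbb{R}^m$. Write $N=\sum_i d_i$, $\mathbf{x}=[x_1^T,\dots,x_n^T]^T\in\mathbb{R}^N$, $A=[A_1,\dots,A_n]$, $f(\mathbf{x})=\sum_i f_i(x_i)$. The original problem is (P) minimize $\sum_{i\in\mathcal{V}}f_i(x_i)$ subject to $x_i\in\mathcal{X}_i$ for all $i$ and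 $\sum_{i\in\mathcal{V}}A_ix_i=c$, with optimal value $f^\star$. **Assumption 1.** (a) Each $f_i$ is $L_i$-smooth for some $L_i>0$, i.e. differentiable with $L_i$-Lipschitz gradient on $\mathbb{R}^{d_i}$. (b) $\mathcal{X}_i=\{x\in\mathbb{R}^{d_i}:g_i^j(x)\le 0,\ j=1,\dots,q_i\}$ for convex, $\beta$-smooth functions $g_i^j:\mathbb{R}^{d_i}\to\mathbb{R}$ (differentiable, with $\beta$-Lipschitz gradient on $\mathbb{R}^{d_i}$), and each $g_i^j$ is $\beta_1$-Lipschitz continuous on $\mathcal{X}_i$. (c) There exist $\{\tilde{x}_i\}_{i\in\mathcal{V}}$ with $\sum_iA_i\tilde{x}_i=c$ and $g_i^j(\tilde{x}_i)<0$ for all $i$ and $j=1,\dots,q_i$. (d) $f^\star>-\infty$. **Assumption 2 (reachability).** For $i\in\mathcal{V}$ let $\mathcal{S}_i=\{\mathbf{u}=[u_1^T,\dots,u_n^T]^T\in\mathbb{R}^N: u_j\in\mathbb{R}^{d_j},\ u_j=\mathbf{0}\ \forall j\notin\bar{\mathcal{N}}_i,\ \sum_{j\in\bar{\mathcal{N}}_i}A_ju_j=\mathbf{0}\}$. Then $\mathcal{S}_1+\dots+\mathcal{S}_n=\operatorname{Null}(A)$ (Minkowski sum). **Barrier problem.** For $\rho>0$, let $\tilde{\mathcal{X}}_i=\{x_i\in\mathbb{R}^{d_i}:g_i^j(x_i)<0,\ j=1,\dots,q_i\}$, $\tilde{\mathcal{X}}=\tilde{\mathcal{X}}_1\times\dots\times\tilde{\mathcal{X}}_n$,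 $B_i(x_i)=-\sum_{j=1}^{q_i}1/g_i^j(x_i)$ for $x_i\in\tilde{\mathcal{X}}_i$, $B(\mathbf{x})=\sum_iB_i(x_i)$, $F(\mathbf{x})=f(\mathbf{x})+\rho B(\mathbf{x})$. (BP) minimize $F(\mathbf{x})$ subject to $\mathbf{x}\in\tilde{\mathcal{X}}$, $A\mathbf{x}=c$. *)

theory Defs
  imports "HOL-Analysis.Analysis" "HOL-Library.Set_Algebras"
begin

text \<open>
  The stacked vector lives in \<^typ>\<open>real^'k\<close>. Each coordinate is owned by one agent in
  \<open>{1..n}\<close>, and agent \<open>i\<close> owns \<open>dims P i\<close> of them, so any family of dimensions can occur. The
  Euclidean space of agent \<open>i\<close>, of dimension \<open>dims P i\<close>, is the coordinate subspace of the
  vectors supported on the coordinates of \<open>i\<close>. The functions \<open>cost P i\<close> and \<open>constr P i j\<close>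
  matter only on this subspace: nothing below depends on their values elsewhere.
\<close>

record ('k, 'm) problem =
  agents :: nat
  edges :: "nat set set"
  dims :: "nat \<Rightarrow> nat"
  owner :: "'k \<Rightarrow> nat"
  cost :: "nat \<Rightarrow> real^'k \<Rightarrow> real"
  nconstr :: "nat \<Rightarrow> nat"
  constr :: "nat \<Rightarrow> nat \<Rightarrow> real^'k \<Rightarrow> real"
  coupling :: "real^'k^'m"
  rhs :: "real^'m"

definition nodes :: "('k::finite, 'm::finite) problem \<Rightarrow> nat set" where
  "nodes P = {1..agents P}"

definition well_formed :: "('k::finite, 'm::finite) problem \<Rightarrow> bool" where
  "well_formed P \<longleftrightarrow>
     edges P \<subseteq> {{i, j} | i j. i \<in> nodes P \<and> j \<in> nodes P} \<and>
     range (owner P) \<subseteq> nodes P \<and>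
     (\<forall>i\<in>nodes P. card {k. owner P k = i} = dims P i)"

definition nbrs :: "('k::finite, 'm::finite) problem \<Rightarrow> nat \<Rightarrow> nat set" where
  "nbrs P i = {j. {i, j} \<in> edges P}"

definition closed_nbrs :: "('k::finite, 'm::finite) problem \<Rightarrow> nat \<Rightarrow> nat set" where
  "closed_nbrs P i = nbrs P i \<union> {i}"

definition local_space :: "('k::finite, 'm::finite) problem \<Rightarrow> nat \<Rightarrow> (real^'k) set" where
  "local_space P i = {x. \<forall>k. owner P k \<noteq> i \<longrightarrow> x $ k = 0}"

definition block :: "('k::finite, 'm::finite) problem \<Rightarrow> nat \<Rightarrow> real^'k \<Rightarrow> real^'k" where
  "block P i x = (\<chi> k. if owner P k = i then x $ k else 0)"

text \<open>
  The columns of \<open>A\<close> belonging to agent \<open>i\<close>, that is \<open>A\<^sub>i\<close>, padded with zero columns.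
\<close>

definition coupling_block :: "('k::finite, 'm::finite) problem \<Rightarrow> nat \<Rightarrow> real^'k^'m" where
  "coupling_block P i = (\<chi> r k. if owner P k = i then coupling P $ r $ k else 0)"

definition total_cost :: "('k::finite, 'm::finite) problem \<Rightarrow> real^'k \<Rightarrow> real" where
  "total_cost P x = (\<Sum>i\<in>nodes P. cost P i (block P i x))"

definition local_set :: "('k::finite, 'm::finite) problem \<Rightarrow> nat \<Rightarrow> (real^'k) set" where
  "local_set P i = {x \<in> local_space P i. \<forall>j\<in>{1..nconstr P i}. constr P i j x \<le> 0}"

definition feasible :: "('k::finite, 'm::finite) problem \<Rightarrow> (real^'k) set" where
  "feasible P = {x. (\<forall>i\<in>nodes P. block P i x \<in> local_set P i) \<and>
                    (\<Sum>i\<in>nodes P. coupling_block P i *v block P i x) = rhs P}"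

definition optimal_value :: "('k::finite, 'm::finite) problem \<Rightarrow> ereal" where
  "optimal_value P = (INF x\<in>feasible P. ereal (total_cost P x))"

definition strict_local_set :: "('k::finite, 'm::finite) problem \<Rightarrow> nat \<Rightarrow> (real^'k) set" where
  "strict_local_set P i = {x \<in> local_space P i. \<forall>j\<in>{1..nconstr P i}. constr P i j x < 0}"

definition local_barrier :: "('k::finite, 'm::finite) problem \<Rightarrow> nat \<Rightarrow> real^'k \<Rightarrow> real" where
  "local_barrier P i x = - (\<Sum>j = 1..nconstr P i. 1 / constr P i j x)"

definition barrier :: "('k::finite, 'm::finite) problem \<Rightarrow> real^'k \<Rightarrow> real" where
  "barrier P x = (\<Sum>i\<in>nodes P. local_barrier P i (block P i x))"

definition barrier_cost :: "('k::finite, 'm::finite) problem \<Rightarrow> real \<Rightarrow> real^'k \<Rightarrow> real" where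
  "barrier_cost P \<rho> x = total_cost P x + \<rho> * barrier P x"

definition barrier_feasible :: "('k::finite, 'm::finite) problem \<Rightarrow> (real^'k) set" where
  "barrier_feasible P =
     {x. (\<forall>i\<in>nodes P. block P i x \<in> strict_local_set P i) \<and> coupling P *v x = rhs P}"

definition barrier_optimal ::
    "('k::finite, 'm::finite) problem \<Rightarrow> real \<Rightarrow> real^'k \<Rightarrow> bool" where
  "barrier_optimal P \<rho> x \<longleftrightarrow> is_arg_min (barrier_cost P \<rho>) (\<lambda>y. y \<in> barrier_feasible P) x"

text \<open>
  Smoothness on a linear subspace \<open>S\<close> regarded as a Euclidean space of its own: the derivative
  is taken within \<open>S\<close> and the gradient, being required to lie in \<open>S\<close>, is unique.
\<close>

definition smooth_within :: "'a::real_inner set \<Rightarrow> real \<Rightarrow> ('a \<Rightarrow> real) \<Rightarrow> bool" where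
  "smooth_within S L h \<longleftrightarrow>
     (\<exists>grad. (\<forall>x\<in>S. grad x \<in> S \<and> (h has_derivative (\<lambda>v. grad x \<bullet> v)) (at x within S)) \<and>
             L-lipschitz_on S grad)"

definition assumption_1 ::
    "('k::finite, 'm::finite) problem \<Rightarrow> (nat \<Rightarrow> real) \<Rightarrow> real \<Rightarrow> real \<Rightarrow> bool" where
  "assumption_1 P L \<beta> \<beta>1 \<longleftrightarrow>
     (\<forall>i\<in>nodes P. L i > 0 \<and> smooth_within (local_space P i) (L i) (cost P i)) \<and>
     (\<forall>i\<in>nodes P. \<forall>j\<in>{1..nconstr P i}.
        convex_on (local_space P i) (constr P i j) \<and>
        smooth_within (local_space P i) \<beta> (constr P i j) \<and>
        \<beta>1-lipschitz_on (local_set P i) (constr P i j)) \<and>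
     (\<exists>x. (\<Sum>i\<in>nodes P. coupling_block P i *v block P i x) = rhs P \<and>
          (\<forall>i\<in>nodes P. \<forall>j\<in>{1..nconstr P i}. constr P i j (block P i x) < 0)) \<and>
     optimal_value P > -\<infinity>"

definition local_null :: "('k::finite, 'm::finite) problem \<Rightarrow> nat \<Rightarrow> (real^'k) set" where
  "local_null P i =
     {u. (\<forall>j\<in>nodes P - closed_nbrs P i. block P j u = 0) \<and>
         (\<Sum>j\<in>closed_nbrs P i. coupling_block P j *v block P j u) = 0}"

text \<open>The sum of sets in the next definition is the Minkowski sum.\<close>

definition assumption_2 :: "('k::finite, 'm::finite) problem \<Rightarrow> bool" where
  "assumption_2 P \<longleftrightarrow> (\<Sum>i\<in>nodes P. local_null P i) = {u. coupling P *v u = 0}"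

end

theory Submission
  imports Defs
begin

text \<open>
  The optimal point of the barrier problem is compared with points on the segments that join
  \<open>x'\<close> to the feasible points \<open>y\<close> of the original problem. Put \<open>z = (1 - t) y + t x'\<close>
  with \<open>0 < t \<le> 1\<close>. Every constraint \<open>g\<close> is convex and \<open>g(y) \<le> 0\<close>, so
  \<open>g(z) \<le> t g(x') < 0\<close>. Hence \<open>z\<close> is admissible for the barrier problem although \<open>y\<close> may
  lie on the boundary, and the barrier blows up at most like \<open>1/t\<close>, that is
  \<open>B(z) \<le> B(x')/t\<close> (lemma \<open>barrier_segment\<close>). Convexity of \<open>f\<close>, optimality of \<open>x_opt\<close> and
  \<open>B(x_opt) \<ge> 0\<close> then give
  \<open>f(x_opt) \<le> F(x_opt) \<le> F(z) \<le> f(y) + t (f(x') - f(y)) + \<rho> B(x')/t\<close>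
  (lemma \<open>barrier_optimal_cost_bound\<close>).

  Here \<open>f(y)\<close> may be replaced by its lower bound \<open>f_low\<close> in the middle term, and \<open>t\<close> is free.
  The two cases of the condition on \<open>\<rho>\<close> are the choices \<open>t = 1\<close> and
  \<open>t = \<epsilon> / (2 (f(x') - f_low))\<close>: the first suffices if \<open>f(x') - f_low\<close> is already at most
  \<open>\<epsilon>/2\<close>, the second makes the middle term equal to \<open>\<epsilon>/2\<close>, and the bound on \<open>\<rho>\<close> makes the last
  term at most \<open>\<epsilon>/2\<close>. So \<open>f(x_opt) \<le> f(y) + \<epsilon>\<close> for every feasible \<open>y\<close>, and the infimum over
  \<open>y\<close> gives the claim.
\<close>

lemma block_in_local_space: "block P i x \<in> local_space P i"
  by (simp add: block_def local_space_def)

lemma block_segment: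
  "block P i (a *\<^sub>R x + b *\<^sub>R y) = a *\<^sub>R block P i x + b *\<^sub>R block P i y"
  by (simp add: block_def vec_eq_iff)

text \<open>
  Every coordinate has exactly one owner among the agents. This identifies the coupling
  constraint of the original problem, written agent by agent, with that of the barrier problem.
\<close>

lemma sum_coupling_block:
  assumes "range (owner P) \<subseteq> nodes P"
  shows "(\<Sum>i\<in>nodes P. coupling_block P i *v block P i x) = coupling P *v x"
proof -
  have "(\<Sum>i\<in>nodes P. (coupling_block P i *v block P i x) $ r) = (coupling P *v x) $ r" for r
  proof -
    have "(\<Sum>i\<in>nodes P. (coupling_block P i *v block P i x) $ r)
        = (\<Sum>i\<in>nodes P. \<Sum>k\<in>UNIV. if owner P k = i then coupling P $ r $ k * x $ k else 0)"
      unfolding matrix_vector_mult_def coupling_block_def block_def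
      by (auto intro!: sum.cong)
    also have "\<dots> = (\<Sum>k\<in>UNIV. \<Sum>i\<in>nodes P. if owner P k = i then coupling P $ r $ k * x $ k else 0)"
      by (rule sum.swap)
    also have "\<dots> = (\<Sum>k\<in>UNIV. coupling P $ r $ k * x $ k)"
    proof (rule sum.cong)
      fix k
      have "owner P k \<in> nodes P"
        using assms by auto
      moreover have "finite (nodes P)"
        by (simp add: nodes_def)
      ultimately show "(\<Sum>i\<in>nodes P. if owner P k = i then coupling P $ r $ k * x $ k else 0)
          = coupling P $ r $ k * x $ k"
        by (simp add: sum.delta')
    qed simp
    finally show ?thesis
      by (simp add: matrix_vector_mult_def)
  qed
  then show ?thesis
    by (simp add: vec_eq_iff)
qed

lemma total_cost_segment:
  assumes "\<forall>i\<in>nodes P. convex_on (local_space P i) (cost P i)" and "0 \<le> t" "t \<le> 1"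
  shows "total_cost P ((1 - t) *\<^sub>R y + t *\<^sub>R x) \<le> (1 - t) * total_cost P y + t * total_cost P x"
  unfolding total_cost_def sum_distrib_left sum.distrib[symmetric] block_segment
  using assms by (intro sum_mono convex_onD[where A = "local_space P _"])
    (auto intro: block_in_local_space)

lemma barrier_nonneg:
  assumes "x \<in> barrier_feasible P"
  shows "0 \<le> barrier P x"
  using assms unfolding barrier_def local_barrier_def barrier_feasible_def strict_local_set_def
  by (auto intro!: sum_nonneg sum_nonpos simp: divide_nonneg_neg divide_nonpos_neg less_imp_le)

text \<open>
  Entering the interior costs little: a convex constraint lies below its chord, and the chord
  from a nonpositive value to \<open>g(x)\<close> is at most \<open>t g(x)\<close> at parameter \<open>t\<close>. Taking reciprocals
  termwise bounds the barrier.
\<close>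

lemma barrier_segment:
  assumes convex: "\<forall>i\<in>nodes P. \<forall>j\<in>{1..nconstr P i}. convex_on (local_space P i) (constr P i j)"
    and owner: "range (owner P) \<subseteq> nodes P"
    and y: "y \<in> feasible P" and x: "x \<in> barrier_feasible P" and t: "0 < t" "t \<le> 1"
  defines "z \<equiv> (1 - t) *\<^sub>R y + t *\<^sub>R x"
  shows "z \<in> barrier_feasible P" and "barrier P z \<le> barrier P x / t"
proof -
  have x_neg: "constr P i j (block P i x) < 0"
    and z_le: "constr P i j (block P i z) \<le> t * constr P i j (block P i x)"
    if i: "i \<in> nodes P" and j: "j \<in> {1..nconstr P i}" for i j
  proof -
    show "constr P i j (block P i x) < 0"
      using x i j by (auto simp: barrier_feasible_def strict_local_set_def)
    have "constr P i j (block P i z)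
        \<le> (1 - t) * constr P i j (block P i y) + t * constr P i j (block P i x)"
      unfolding z_def block_segment
      using convex i j t by (intro convex_onD[where A = "local_space P i"])
        (auto intro: block_in_local_space)
    moreover have "constr P i j (block P i y) \<le> 0"
      using y i j by (auto simp: feasible_def local_set_def)
    then have "(1 - t) * constr P i j (block P i y) \<le> 0"
      using t by (simp add: mult_nonneg_nonpos)
    ultimately show "constr P i j (block P i z) \<le> t * constr P i j (block P i x)"
      by linarith
  qed
  have tx_neg: "t * constr P i j (block P i x) < 0"
    if "i \<in> nodes P" "j \<in> {1..nconstr P i}" for i j
    using x_neg[OF that] t by (simp add: mult_pos_neg)
  have z_neg: "constr P i j (block P i z) < 0"
    if "i \<in> nodes P" "j \<in> {1..nconstr P i}" for i j
    using z_le[OF that] tx_neg[OF that] by linarith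

  have "coupling P *v y = rhs P"
    using y sum_coupling_block[OF owner, of y] by (simp add: feasible_def)
  moreover have "coupling P *v x = rhs P"
    using x by (simp add: barrier_feasible_def)
  ultimately have "coupling P *v z = rhs P"
    by (simp add: z_def matrix_vector_right_distrib matrix_vector_mult_scaleR
        flip: scaleR_add_left)
  then show "z \<in> barrier_feasible P"
    using z_neg by (auto simp: barrier_feasible_def strict_local_set_def block_in_local_space)

  have "local_barrier P i (block P i z) \<le> local_barrier P i (block P i x) / t"
    if i: "i \<in> nodes P" for i
  proof -
    have "(1 / constr P i j (block P i x)) / t \<le> 1 / constr P i j (block P i z)"
      if j: "j \<in> {1..nconstr P i}" for j
    proof -
      have "1 / (t * constr P i j (block P i x)) \<le> 1 / constr P i j (block P i z)"
        using le_imp_inverse_le_neg[OF z_le[OF i j] tx_neg[OF i j]]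
        by (simp add: inverse_eq_divide)
      then show ?thesis
        by (simp add: mult.commute)
    qed
    then have "(\<Sum>j = 1..nconstr P i. 1 / constr P i j (block P i x)) / t
        \<le> (\<Sum>j = 1..nconstr P i. 1 / constr P i j (block P i z))"
      unfolding sum_divide_distrib by (intro sum_mono)
    then show ?thesis
      by (simp add: local_barrier_def)
  qed
  then show "barrier P z \<le> barrier P x / t"
    unfolding barrier_def sum_divide_distrib by (intro sum_mono)
qed

text \<open>
  The parameter \<open>t\<close> balances two errors: a large \<open>t\<close> moves the comparison point away from \<open>y\<close>
  and changes the cost, a small \<open>t\<close> brings it close to the boundary and raises the barrier.
\<close>

lemma barrier_optimal_cost_bound:
  assumes "\<forall>i\<in>nodes P. convex_on (local_space P i) (cost P i)"
    and "\<forall>i\<in>nodes P. \<forall>j\<in>{1..nconstr P i}. convex_on (local_space P i) (constr P i j)"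
    and "range (owner P) \<subseteq> nodes P"
    and opt: "barrier_optimal P \<rho> x_opt" and "0 \<le> \<rho>"
    and "y \<in> feasible P" and "x \<in> barrier_feasible P" and "0 < t" "t \<le> 1"
  shows "total_cost P x_opt
    \<le> total_cost P y + t * (total_cost P x - total_cost P y) + \<rho> * (barrier P x / t)"
proof -
  define z where "z = (1 - t) *\<^sub>R y + t *\<^sub>R x"
  have z: "z \<in> barrier_feasible P" and z_barrier: "barrier P z \<le> barrier P x / t"
    using barrier_segment[of P y x t] assms by (simp_all add: z_def)
  have x_opt: "x_opt \<in> barrier_feasible P" and "barrier_cost P \<rho> x_opt \<le> barrier_cost P \<rho> z"
    using opt z by (auto simp: barrier_optimal_def is_arg_min_linorder)
  moreover have "0 \<le> \<rho> * barrier P x_opt"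
    using barrier_nonneg[OF x_opt] \<open>0 \<le> \<rho>\<close> by simp
  ultimately have "total_cost P x_opt \<le> total_cost P z + \<rho> * barrier P z"
    by (simp add: barrier_cost_def)
  also have "\<rho> * barrier P z \<le> \<rho> * (barrier P x / t)"
    using z_barrier \<open>0 \<le> \<rho>\<close> by (rule mult_left_mono)
  also have "total_cost P z \<le> (1 - t) * total_cost P y + t * total_cost P x"
    unfolding z_def using assms by (intro total_cost_segment) auto
  finally show ?thesis
    by (simp add: algebra_simps)
qed

theorem lemma2:
  fixes P :: "('k::finite, 'm::finite) problem"
    and L :: "nat \<Rightarrow> real" and \<beta> \<beta>1 \<rho> \<epsilon> f_low :: real
    and x_opt x' :: "real^'k"
  assumes "well_formed P"
    and "assumption_1 P L \<beta> \<beta>1"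
    and "assumption_2 P"
    and "\<forall>i\<in>nodes P. convex_on (local_space P i) (cost P i)"
    and "ereal f_low \<le> optimal_value P"
    and "\<epsilon> > 0"
    and "x' \<in> barrier_feasible P"
    and "0 < \<rho>"
    and "\<rho> \<le> (if total_cost P x' - f_low \<le> \<epsilon> / 2
               then \<epsilon> / (2 * barrier P x')
               else \<epsilon>\<^sup>2 / (4 * (total_cost P x' - f_low) * barrier P x'))"
    and "barrier_optimal P \<rho> x_opt"
  shows "ereal (total_cost P x_opt) - optimal_value P \<le> ereal \<epsilon>"
proof -
  let ?f = "total_cost P" and ?D = "total_cost P x' - f_low" and ?B = "barrier P x'"
  have owner: "range (owner P) \<subseteq> nodes P"
    using assms(1) by (simp add: well_formed_def)
  have constr_convex:
    "\<forall>i\<in>nodes P. \<forall>j\<in>{1..nconstr P i}. convex_on (local_space P i) (constr P i j)"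
    using assms(2) by (simp add: assumption_1_def)
  have bound: "?f x_opt \<le> ?f y + t * (?f x' - ?f y) + \<rho> * (?B / t)"
    if "y \<in> feasible P" "0 < t" "t \<le> 1" for y t
    using barrier_optimal_cost_bound[OF assms(4) constr_convex owner assms(10)] assms(7,8) that
    by simp
  have "0 \<le> ?B"
    by (rule barrier_nonneg) fact
  \<comment> \<open>If the barrier vanishes at \<open>x'\<close>, the bound on \<open>\<rho>\<close> is \<open>_ / 0 = 0\<close> and contradicts
    \<open>0 < \<rho>\<close>.\<close>
  moreover have "?B \<noteq> 0"
    using assms(8,9) by (auto split: if_splits)
  ultimately have B: "0 < ?B"
    by simp
  have near_optimal: "?f x_opt - \<epsilon> \<le> ?f y" if y: "y \<in> feasible P" for y
  proof -
    have "optimal_value P \<le> ereal (?f y)"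
      unfolding optimal_value_def using y by (rule INF_lower)
    then have low: "f_low \<le> ?f y"
      using assms(5) by (metis order_trans ereal_less_eq(3))
    show ?thesis
    proof (cases "?D \<le> \<epsilon> / 2")
      case True
      then have "\<rho> * ?B \<le> \<epsilon> / 2"
        using assms(9) B by (simp add: field_simps)
      with bound[OF y, of 1] True low show ?thesis
        by simp
    next
      case False
      define t where "t = \<epsilon> / (2 * ?D)"
      have D: "0 < ?D" and t: "0 < t" "t \<le> 1"
        using False assms(6) by (auto simp: t_def divide_simps)
      have "t * (?f x' - ?f y) \<le> t * ?D"
        using low t by simp
      also have "\<dots> = \<epsilon> / 2"
        using D unfolding t_def by (simp del: right_diff_distrib_numeral)
      finally have cost_error: "t * (?f x' - ?f y) \<le> \<epsilon> / 2" .
      have "\<rho> * ?B \<le> \<epsilon>\<^sup>2 / (4 * ?D * ?B) * ?B"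
        using assms(9) B False by (intro mult_right_mono) auto
      also have "\<dots> = \<epsilon> / 2 * t"
        using B D by (simp add: t_def power2_eq_square)
      finally have "\<rho> * (?B / t) \<le> \<epsilon> / 2"
        using t by (simp add: divide_le_eq)
      with cost_error bound[OF y t] show ?thesis
        by linarith
    qed
  qed
  then have "ereal (?f x_opt - \<epsilon>) \<le> optimal_value P"
    unfolding optimal_value_def by (intro INF_greatest) simp
  then show ?thesis
    by (cases "optimal_value P") (auto simp: algebra_simps)
qed

end
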